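(* Let $f:B\to A$ and $g:C\to A$ be two covers, and let $B\xleftarrow{p}U\xrightarrow{q}C$ be a pullback (in $\mathbf C$) of $B\xrightarrow{f}A\xleftarrow{g}C$. For every $i\in\Sigma(U)$ with $\deg(q\circ i)=1$ the cover $q\circ i$ is an isomorphism, and the map $$\Phi:\{i\in\Sigma(U)\mid \deg(q\circ i)=1\}\to {\rm Hom}(g,f),\qquad i\mapsto p\circ i\circ (q\circ i)^{-1}$$ is a well-defined bijection. In particular $|{\rm Hom}(g,f)|\le \deg f$, with equality if and only if $\deg(q\circ i)=1$ for all $i\in\Sigma(U)$.
   Context: Let $\mathbf C$ be a category and $\mathbf D$ a full subcategory of $\mathbf C$. For arrows $f,g$ of $\mathbf C$ with ${\rm cod}\,f={\rm cod}\,g$, ${\rm Hom}(g,f)$ denotes the collection of all arrows $h$ of $\mathbf C$ with $g=f\circ h$. Standing assumptions: (G1) every diagram $B\to A\leftarrow C$ in $\mathbf D$ has a pullback in $\mathbf C$. (G2) (I) pushouts exist in $\mathbf D$; (II) every arrow of $\mathbf D$ is epic; (III) every monic arrow of $\mathbf D$ is an isomorphism whose inverse is an arrow of $\mathbf D$. (G3) for every object $U$ of $\mathbf C$ there is a set $\Sigma(U)$ of arrows $i$ of $\mathbf C$ with ${\rm dom}\,i$ in $\mathbf D$ and ${\rm cod}\,i=U$ such that for every arrow $u$ of $\mathbf C$ with ${\rm dom}\,u$ in $\mathbf D$ and ${\rm cod}\,u=U$ there is exactly one $i\in\Sigma(U)$ with ${\rm Hom}(u,i)\neq\emptyset$. (G4)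 there is a function $\deg$ from the collection of arrows of $\mathbf C$ whose codomain lies in $\mathbf D$ to the positive integers such that (I) $\deg(g\circ f)=\deg g\cdot\deg f$ whenever $f,g,g\circ f$ all lie in this collection; (II) $\deg f=\sum_{i\in\Sigma({\rm dom}\,f)}\deg(f\circ i)$ for every such $f$; (III) if $B\xrightarrow{f}A\xleftarrow{g}C$ is a diagram in $\mathbf D$ with pullback $B\xleftarrow{p}U\xrightarrow{q}C$, then $\deg f=\deg q$ and $\deg g=\deg p$. A cover is an arrow of $\mathbf D$. *)

theory Defs
  imports Main
begin

text \<open>
  Arrow composition is a total function in HOL; its value is only meaningful on composable
  pairs of arrows, so every notion below carries the domain and codomain conditions explicitly.
\<close>

record ('o, 'a) cat =
  Obj :: "'o set"
  Arr :: "'a set"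
  Dom :: "'a \<Rightarrow> 'o"
  Cod :: "'a \<Rightarrow> 'o"
  Ide :: "'o \<Rightarrow> 'a"
  Comp :: "'a \<Rightarrow> 'a \<Rightarrow> 'a"  (infixl "\<cdot>\<index>" 70)

locale category =
  fixes C :: "('o, 'a) cat" (structure)
  assumes Dom_Obj: "f \<in> Arr C \<Longrightarrow> Dom C f \<in> Obj C"
    and Cod_Obj: "f \<in> Arr C \<Longrightarrow> Cod C f \<in> Obj C"
    and Ide_Arr: "X \<in> Obj C \<Longrightarrow> Ide C X \<in> Arr C"
    and Dom_Ide: "X \<in> Obj C \<Longrightarrow> Dom C (Ide C X) = X"
    and Cod_Ide: "X \<in> Obj C \<Longrightarrow> Cod C (Ide C X) = X"
    and Comp_Arr: "\<lbrakk>f \<in> Arr C; g \<in> Arr C; Cod C f = Dom C g\<rbrakk> \<Longrightarrow> g \<cdot> f \<in> Arr C"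
    and Dom_Comp: "\<lbrakk>f \<in> Arr C; g \<in> Arr C; Cod C f = Dom C g\<rbrakk> \<Longrightarrow> Dom C (g \<cdot> f) = Dom C f"
    and Cod_Comp: "\<lbrakk>f \<in> Arr C; g \<in> Arr C; Cod C f = Dom C g\<rbrakk> \<Longrightarrow> Cod C (g \<cdot> f) = Cod C g"
    and Comp_assoc:
      "\<lbrakk>f \<in> Arr C; g \<in> Arr C; h \<in> Arr C; Cod C f = Dom C g; Cod C g = Dom C h\<rbrakk>
        \<Longrightarrow> h \<cdot> g \<cdot> f = h \<cdot> (g \<cdot> f)"
    and Comp_Ide_right: "f \<in> Arr C \<Longrightarrow> f \<cdot> Ide C (Dom C f) = f"
    and Comp_Ide_left: "f \<in> Arr C \<Longrightarrow> Ide C (Cod C f) \<cdot> f = f"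

definition full_subcategory :: "('o, 'a) cat \<Rightarrow> ('o, 'a) cat \<Rightarrow> bool" where
  "full_subcategory D C \<longleftrightarrow>
     Obj D \<subseteq> Obj C \<and>
     Arr D = {h \<in> Arr C. Dom C h \<in> Obj D \<and> Cod C h \<in> Obj D} \<and>
     (\<forall>h\<in>Arr D. Dom D h = Dom C h \<and> Cod D h = Cod C h) \<and>
     (\<forall>X\<in>Obj D. Ide D X = Ide C X) \<and>
     (\<forall>g\<in>Arr D. \<forall>h\<in>Arr D. Cod C h = Dom C g \<longrightarrow> g \<cdot>\<^bsub>D\<^esub> h = g \<cdot>\<^bsub>C\<^esub> h)"

lemma full_subcategory_category:
  assumes "category C" "full_subcategory D C"
  shows "category D"
proof -
  interpret category C by fact
  show ?thesis
    using assms(2) Dom_Obj Cod_Obj Ide_Arr Dom_Ide Cod_Ide Comp_Arr Dom_Comp Cod_Comp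
      Comp_assoc Comp_Ide_right Comp_Ide_left
    unfolding full_subcategory_def by unfold_locales (auto simp: subset_iff)
qed

definition monic :: "('o, 'a) cat \<Rightarrow> 'a \<Rightarrow> bool" where
  "monic C h \<longleftrightarrow> h \<in> Arr C \<and>
     (\<forall>x\<in>Arr C. \<forall>y\<in>Arr C. Dom C x = Dom C y \<and> Cod C x = Dom C h \<and> Cod C y = Dom C h \<and>
        h \<cdot>\<^bsub>C\<^esub> x = h \<cdot>\<^bsub>C\<^esub> y \<longrightarrow> x = y)"

definition epic :: "('o, 'a) cat \<Rightarrow> 'a \<Rightarrow> bool" where
  "epic C h \<longleftrightarrow> h \<in> Arr C \<and>
     (\<forall>x\<in>Arr C. \<forall>y\<in>Arr C. Cod C x = Cod C y \<and> Dom C x = Cod C h \<and> Dom C y = Cod C h \<and>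
        x \<cdot>\<^bsub>C\<^esub> h = y \<cdot>\<^bsub>C\<^esub> h \<longrightarrow> x = y)"

definition inverse_arrows :: "('o, 'a) cat \<Rightarrow> 'a \<Rightarrow> 'a \<Rightarrow> bool" where
  "inverse_arrows C h k \<longleftrightarrow> h \<in> Arr C \<and> k \<in> Arr C \<and>
     Dom C k = Cod C h \<and> Cod C k = Dom C h \<and>
     k \<cdot>\<^bsub>C\<^esub> h = Ide C (Dom C h) \<and> h \<cdot>\<^bsub>C\<^esub> k = Ide C (Cod C h)"

definition isomorphism :: "('o, 'a) cat \<Rightarrow> 'a \<Rightarrow> bool" where
  "isomorphism C h \<longleftrightarrow> (\<exists>k. inverse_arrows C h k)"

definition inv_arrow :: "('o, 'a) cat \<Rightarrow> 'a \<Rightarrow> 'a" where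
  "inv_arrow C h = (THE k. inverse_arrows C h k)"

lemma inv_arrow_eq:
  assumes "category C" "inverse_arrows C h k"
  shows "inv_arrow C h = k"
  unfolding inv_arrow_def
proof (rule the_equality)
  interpret category C by fact
  fix l assume "inverse_arrows C h l"
  with assms(2) show "l = k"
    unfolding inverse_arrows_def by (metis Comp_assoc Comp_Ide_left Comp_Ide_right)
qed fact

definition pullback :: "('o, 'a) cat \<Rightarrow> 'a \<Rightarrow> 'a \<Rightarrow> 'a \<Rightarrow> 'a \<Rightarrow> bool" where
  "pullback C f g p q \<longleftrightarrow>
     f \<in> Arr C \<and> g \<in> Arr C \<and> p \<in> Arr C \<and> q \<in> Arr C \<and>
     Cod C f = Cod C g \<and> Dom C p = Dom C q \<and> Cod C p = Dom C f \<and> Cod C q = Dom C g \<and>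
     f \<cdot>\<^bsub>C\<^esub> p = g \<cdot>\<^bsub>C\<^esub> q \<and>
     (\<forall>x\<in>Arr C. \<forall>y\<in>Arr C.
        Dom C x = Dom C y \<and> Cod C x = Dom C f \<and> Cod C y = Dom C g \<and> f \<cdot>\<^bsub>C\<^esub> x = g \<cdot>\<^bsub>C\<^esub> y \<longrightarrow>
        (\<exists>!u. u \<in> Arr C \<and> Dom C u = Dom C x \<and> Cod C u = Dom C p \<and>
              p \<cdot>\<^bsub>C\<^esub> u = x \<and> q \<cdot>\<^bsub>C\<^esub> u = y))"

definition pushout :: "('o, 'a) cat \<Rightarrow> 'a \<Rightarrow> 'a \<Rightarrow> 'a \<Rightarrow> 'a \<Rightarrow> bool" where
  "pushout C f g p q \<longleftrightarrow>
     f \<in> Arr C \<and> g \<in> Arr C \<and> p \<in> Arr C \<and> q \<in> Arr C \<and>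
     Dom C f = Dom C g \<and> Cod C p = Cod C q \<and> Dom C p = Cod C f \<and> Dom C q = Cod C g \<and>
     p \<cdot>\<^bsub>C\<^esub> f = q \<cdot>\<^bsub>C\<^esub> g \<and>
     (\<forall>x\<in>Arr C. \<forall>y\<in>Arr C.
        Cod C x = Cod C y \<and> Dom C x = Cod C f \<and> Dom C y = Cod C g \<and> x \<cdot>\<^bsub>C\<^esub> f = y \<cdot>\<^bsub>C\<^esub> g \<longrightarrow>
        (\<exists>!u. u \<in> Arr C \<and> Dom C u = Cod C p \<and> Cod C u = Cod C x \<and>
              u \<cdot>\<^bsub>C\<^esub> p = x \<and> u \<cdot>\<^bsub>C\<^esub> q = y))"

definition Hom :: "('o, 'a) cat \<Rightarrow> 'a \<Rightarrow> 'a \<Rightarrow> 'a set" where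
  "Hom C g f = {h \<in> Arr C. Dom C h = Dom C g \<and> Cod C h = Dom C f \<and> g = f \<cdot>\<^bsub>C\<^esub> h}"

text \<open>
  \<open>\<Sigma>\<close> and \<open>deg\<close> are the chosen data whose existence the axioms assert. Epic, monic and pushout
  refer to \<open>D\<close> as a category in its own right; pullbacks are taken in \<open>C\<close>.
  A finite \<open>\<Sigma> (Dom C f)\<close> is what makes the sum in \<open>deg_sum\<close> a positive integer; as \<open>sum\<close> is \<open>0\<close>
  over infinite sets, it also follows from that equation and \<open>deg_pos\<close>.
\<close>

locale cover_setting = category C
  for C :: "('o, 'a) cat" (structure) +
  fixes D :: "('o, 'a) cat"
    and \<Sigma> :: "'o \<Rightarrow> 'a set"
    and deg :: "'a \<Rightarrow> nat"
  assumes full_sub: "full_subcategory D C"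
    and pullbacks: "\<lbrakk>f \<in> Arr D; g \<in> Arr D; Cod C f = Cod C g\<rbrakk> \<Longrightarrow> \<exists>p q. pullback C f g p q"
    and pushouts: "\<lbrakk>f \<in> Arr D; g \<in> Arr D; Dom C f = Dom C g\<rbrakk> \<Longrightarrow> \<exists>p q. pushout D f g p q"
    and all_epic: "h \<in> Arr D \<Longrightarrow> epic D h"
    and monic_iso: "monic D h \<Longrightarrow> \<exists>k\<in>Arr D. inverse_arrows C h k"
    and Sigma_Arr: "\<lbrakk>U \<in> Obj C; i \<in> \<Sigma> U\<rbrakk> \<Longrightarrow> i \<in> Arr C \<and> Dom C i \<in> Obj D \<and> Cod C i = U"
    and Sigma_ex1: "\<lbrakk>U \<in> Obj C; u \<in> Arr C; Dom C u \<in> Obj D; Cod C u = U\<rbrakk>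
        \<Longrightarrow> \<exists>!i. i \<in> \<Sigma> U \<and> Hom C u i \<noteq> {}"
    and deg_pos: "\<lbrakk>f \<in> Arr C; Cod C f \<in> Obj D\<rbrakk> \<Longrightarrow> deg f > 0"
    and deg_mult: "\<lbrakk>f \<in> Arr C; g \<in> Arr C; Cod C f = Dom C g; Cod C f \<in> Obj D; Cod C g \<in> Obj D\<rbrakk>
        \<Longrightarrow> deg (g \<cdot> f) = deg g * deg f"
    and deg_sum: "\<lbrakk>f \<in> Arr C; Cod C f \<in> Obj D\<rbrakk>
        \<Longrightarrow> finite (\<Sigma> (Dom C f)) \<and> deg f = (\<Sum>i\<in>\<Sigma> (Dom C f). deg (f \<cdot> i))"
    and deg_pullback: "\<lbrakk>f \<in> Arr D; g \<in> Arr D; pullback C f g p q\<rbrakk>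
        \<Longrightarrow> deg f = deg q \<and> deg g = deg p"

end

theory Submission
  imports Defs
begin

text \<open>
  A cover \<open>h\<close> of degree 1 is monic, hence an isomorphism: in its kernel pair \<open>p, q\<close> the arrow \<open>q\<close>
  has degree 1, so \<open>\<Sigma>\<close> of its domain is a single arrow \<open>i\<close>. The diagonal factors as \<open>i \<cdot> s\<close>
  with \<open>s\<close> epic, which forces \<open>p \<cdot> i = q \<cdot> i\<close>, and every pair identified by \<open>h\<close>
  factors through \<open>i\<close>. Arrows in \<open>Hom(g, f)\<close> correspond to sections of the pullback projection
  \<open>q\<close>, and the unique \<open>i\<close> in \<open>\<Sigma>(U)\<close> through which a section factors has
  \<open>deg(q \<cdot> i) = 1\<close>. The counting claims compare the sum
  \<open>deg f = deg q = \<Sum>\<^sub>i deg(q \<cdot> i)\<close> of positive integers with its number of terms equal to 1.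
\<close>

text \<open>The terms equal to 1 sum to their own number. The surplus is the sum of the remaining
  terms, which are positive, so it vanishes only if there are none.\<close>

lemma card_eq_one_terms_le_sum:
  fixes d :: "'i \<Rightarrow> nat"
  assumes "finite S" and pos: "\<And>i. i \<in> S \<Longrightarrow> d i > 0"
  shows "card {i \<in> S. d i = 1} \<le> sum d S"
    and "card {i \<in> S. d i = 1} = sum d S \<longleftrightarrow> (\<forall>i\<in>S. d i = 1)"
proof -
  let ?T = "{i \<in> S. d i = 1}"
  have "sum d S = sum d ?T + sum d (S - ?T)"
    using sum.subset_diff[of ?T S d] assms(1) by (simp add: add.commute)
  then have split: "sum d S = card ?T + sum d (S - ?T)"
    by simp
  then show "card ?T \<le> sum d S"
    by simp
  have "card ?T = sum d S \<longleftrightarrow> (\<forall>i\<in>S - ?T. d i = 0)"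
    using split assms(1) by simp
  also have "\<dots> \<longleftrightarrow> (\<forall>i\<in>S. d i = 1)"
    using pos[THEN gr_implies_not0] by blast
  finally show "card ?T = sum d S \<longleftrightarrow> (\<forall>i\<in>S. d i = 1)" .
qed

section \<open>Mediating arrows of pullbacks\<close>

context category
begin

lemma pullback_ex1:
  assumes "pullback C f g p q" "x \<in> Arr C" "y \<in> Arr C"
    and "Dom C x = Dom C y" "Cod C x = Dom C f" "Cod C y = Dom C g" "f \<cdot> x = g \<cdot> y"
  shows "\<exists>!u. u \<in> Arr C \<and> Dom C u = Dom C x \<and> Cod C u = Dom C p \<and> p \<cdot> u = x \<and> q \<cdot> u = y"
  using assms unfolding pullback_def by blast

lemma pullback_lift:
  assumes "pullback C f g p q" "x \<in> Arr C" "y \<in> Arr C"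
    and "Dom C x = Dom C y" "Cod C x = Dom C f" "Cod C y = Dom C g" "f \<cdot> x = g \<cdot> y"
  obtains u where "u \<in> Arr C" "Dom C u = Dom C x" "Cod C u = Dom C p" "p \<cdot> u = x" "q \<cdot> u = y"
  using pullback_ex1[OF assms] by blast

text \<open>Both arrows mediate for the same pair \<open>p \<cdot> u\<close>,
  \<open>q \<cdot> u\<close>, and the mediating arrow is unique.\<close>

lemma pullback_jointly_monic:
  assumes pb: "pullback C f g p q" and u: "u \<in> Arr C" "Cod C u = Dom C p"
    and v: "v \<in> Arr C" "Cod C v = Dom C p" "Dom C v = Dom C u"
    and eq: "p \<cdot> v = p \<cdot> u" "q \<cdot> v = q \<cdot> u"
  shows "u = v"
proof -
  have pq: "f \<in> Arr C" "g \<in> Arr C" "p \<in> Arr C" "q \<in> Arr C" "Dom C p = Dom C q"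
    "Cod C p = Dom C f" "Cod C q = Dom C g" "f \<cdot> p = g \<cdot> q"
    using pb by (auto simp: pullback_def)
  have "f \<cdot> (p \<cdot> u) = f \<cdot> p \<cdot> u"
    using pq(1-7) u by (simp add: Comp_assoc)
  also have "\<dots> = g \<cdot> (q \<cdot> u)"
    unfolding pq(8) using pq(1-7) u by (simp add: Comp_assoc)
  finally have "\<exists>!w. w \<in> Arr C \<and> Dom C w = Dom C (p \<cdot> u) \<and> Cod C w = Dom C p \<and>
      p \<cdot> w = p \<cdot> u \<and> q \<cdot> w = q \<cdot> u"
    using pq(1-7) u
    by (intro pullback_ex1[OF pb]) (simp_all add: Comp_Arr Dom_Comp Cod_Comp)
  moreover have "Dom C (p \<cdot> u) = Dom C u"
    using pq(1-7) u by (simp add: Dom_Comp)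
  ultimately show ?thesis
    using u v eq by metis
qed

end

section \<open>Covers, factorization through \<open>\<Sigma>\<close>, and covers of degree 1\<close>

context cover_setting
begin

lemma Obj_D: "X \<in> Obj D \<Longrightarrow> X \<in> Obj C"
  and Arr_D_iff: "h \<in> Arr D \<longleftrightarrow> h \<in> Arr C \<and> Dom C h \<in> Obj D \<and> Cod C h \<in> Obj D"
  and Dom_D: "h \<in> Arr D \<Longrightarrow> Dom D h = Dom C h"
  and Cod_D: "h \<in> Arr D \<Longrightarrow> Cod D h = Cod C h"
  and Comp_D: "\<lbrakk>k \<in> Arr D; h \<in> Arr D; Cod C h = Dom C k\<rbrakk> \<Longrightarrow> k \<cdot>\<^bsub>D\<^esub> h = k \<cdot> h"
  using full_sub unfolding full_subcategory_def by auto

lemma monic_D_I: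
  assumes "h \<in> Arr D"
    and "\<And>x y. \<lbrakk>x \<in> Arr D; y \<in> Arr D; Dom C x = Dom C y; Cod C x = Dom C h; Cod C y = Dom C h;
      h \<cdot> x = h \<cdot> y\<rbrakk> \<Longrightarrow> x = y"
  shows "monic D h"
  using assms by (auto simp: monic_def Dom_D Cod_D Comp_D)

text \<open>Epicness is available only inside \<open>D\<close>, hence the demand that
  \<open>x\<close> and \<open>y\<close> be covers too.\<close>

lemma cover_cancel_right:
  assumes "h \<in> Arr D" "x \<in> Arr D" "y \<in> Arr D" "Cod C x = Cod C y"
    and "Dom C x = Cod C h" "Dom C y = Cod C h" "x \<cdot> h = y \<cdot> h"
  shows "x = y"
proof -
  have "x \<cdot>\<^bsub>D\<^esub> h = y \<cdot>\<^bsub>D\<^esub> h"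
    using assms by (simp add: Comp_D)
  moreover have "Cod D x = Cod D y" "Dom D x = Cod D h" "Dom D y = Cod D h"
    using assms(1-6) by (simp_all add: Dom_D Cod_D)
  ultimately show ?thesis
    using all_epic[OF assms(1)] assms(2,3) unfolding epic_def by blast
qed

text \<open>From \<open>t \<cdot> s\<close> being an identity, \<open>s \<cdot> t\<close> and the
  identity agree after composition with \<open>s\<close>, and the epic \<open>s\<close> can be
  cancelled.\<close>

lemma left_inverse_cover_inverse_arrows:
  assumes s: "s \<in> Arr D" and t: "t \<in> Arr D" "Dom C t = Cod C s" "Cod C t = Dom C s"
    and ts: "t \<cdot> s = Ide C (Dom C s)"
  shows "inverse_arrows C t s"
proof -
  have arr: "s \<in> Arr C" "t \<in> Arr C" "Dom C s \<in> Obj D" "Cod C s \<in> Obj D"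
    using s t by (auto simp: Arr_D_iff)
  have "s \<cdot> t \<cdot> s = s \<cdot> (t \<cdot> s)"
    using arr t by (simp add: Comp_assoc)
  also have "\<dots> = s"
    unfolding ts using arr by (simp add: Comp_Ide_right)
  also have "\<dots> = Ide C (Cod C s) \<cdot> s"
    using arr by (simp add: Comp_Ide_left)
  finally have eq: "s \<cdot> t \<cdot> s = Ide C (Cod C s) \<cdot> s" .
  have "s \<cdot> t = Ide C (Cod C s)"
    by (rule cover_cancel_right[OF s _ _ _ _ _ eq])
      (use arr t in \<open>auto simp: Arr_D_iff Comp_Arr Dom_Comp Cod_Comp Ide_Arr Dom_Ide Cod_Ide Obj_D\<close>)
  then show ?thesis
    using arr t ts by (simp add: inverse_arrows_def)
qed

text \<open>Existence half of (G3). The factor \<open>t\<close> is a cover because \<open>D\<close>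
  is full and both ends of \<open>t\<close> lie in \<open>D\<close>.\<close>

lemma Sigma_factor:
  assumes "u \<in> Arr C" "Dom C u \<in> Obj D" "Cod C u = U"
  obtains i t where "i \<in> \<Sigma> U" "i \<in> Arr C" "Dom C i \<in> Obj D" "Cod C i = U"
    "t \<in> Arr D" "Dom C t = Dom C u" "Cod C t = Dom C i" "i \<cdot> t = u"
proof -
  have U: "U \<in> Obj C"
    using assms Cod_Obj by blast
  then obtain i t where i: "i \<in> \<Sigma> U" and "t \<in> Hom C u i"
    using Sigma_ex1 assms by blast
  then have t: "t \<in> Arr C" "Dom C t = Dom C u" "Cod C t = Dom C i" "i \<cdot> t = u"
    unfolding Hom_def by auto
  show thesis
  proof (rule that[OF i])
    show "t \<in> Arr D"
      unfolding Arr_D_iff using t(1-3) Sigma_Arr[OF U i] assms(2) by simp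
  qed (use t Sigma_Arr[OF U i] in blast)+
qed

text \<open>Uniqueness half of (G3), applied to the common composite, which factors through both
  \<open>i\<close> and \<open>j\<close>.\<close>

lemma Sigma_unique:
  assumes "i \<in> \<Sigma> U" "j \<in> \<Sigma> U" "U \<in> Obj C"
    and "s \<in> Arr D" "Cod C s = Dom C i" "t \<in> Arr D" "Cod C t = Dom C j" "i \<cdot> s = j \<cdot> t"
  shows "i = j"
proof -
  have i: "i \<in> Arr C" "Cod C i = U" and j: "j \<in> Arr C"
    using assms Sigma_Arr by auto
  have "Dom C s = Dom C t"
    using assms i j by (metis Arr_D_iff Dom_Comp)
  then have "s \<in> Hom C (i \<cdot> s) i" "t \<in> Hom C (i \<cdot> s) j"
    using assms i j by (auto simp: Hom_def Arr_D_iff Dom_Comp)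
  moreover have "i \<cdot> s \<in> Arr C" "Dom C (i \<cdot> s) \<in> Obj D" "Cod C (i \<cdot> s) = U"
    using assms(4,5) i by (auto simp: Arr_D_iff Comp_Arr Dom_Comp Cod_Comp)
  ultimately show ?thesis
    using Sigma_ex1[OF assms(3)] assms(1,2) by blast
qed

text \<open>An identity is idempotent, so its degree is a positive solution of
  \<open>n = n * n\<close>.\<close>

lemma deg_Ide:
  assumes "X \<in> Obj D"
  shows "deg (Ide C X) = 1"
proof -
  have I: "Ide C X \<in> Arr C" "Dom C (Ide C X) = X" "Cod C (Ide C X) = X"
    using assms by (auto simp: Ide_Arr Dom_Ide Cod_Ide Obj_D)
  then have "Ide C X \<cdot> Ide C X = Ide C X"
    using Comp_Ide_left by fastforce
  then have "deg (Ide C X) = deg (Ide C X) * deg (Ide C X)"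
    using deg_mult[of "Ide C X" "Ide C X"] I assms by simp
  moreover have "deg (Ide C X) > 0"
    using deg_pos I assms by simp
  ultimately show ?thesis
    by simp
qed

lemma deg_Comp_Sigma_pos:
  assumes "h \<in> Arr C" "Cod C h \<in> Obj D" "i \<in> \<Sigma> (Dom C h)"
  shows "deg (h \<cdot> i) > 0"
  using assms Sigma_Arr[OF Dom_Obj] by (intro deg_pos) (auto simp: Comp_Arr Cod_Comp)

text \<open>Two distinct elements would contribute at least 2 to a sum of value 1.\<close>

lemma deg_one_Sigma_unique:
  assumes "h \<in> Arr C" "Cod C h \<in> Obj D" "deg h = 1" "i \<in> \<Sigma> (Dom C h)" "j \<in> \<Sigma> (Dom C h)"
  shows "i = j"
proof (rule ccontr)
  assume "i \<noteq> j"
  have fin: "finite (\<Sigma> (Dom C h))" and "(\<Sum>k\<in>\<Sigma> (Dom C h). deg (h \<cdot> k)) = 1"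
    using deg_sum[OF assms(1,2)] assms(3) by auto
  moreover have "(\<Sum>k\<in>{i, j}. deg (h \<cdot> k)) \<le> (\<Sum>k\<in>\<Sigma> (Dom C h). deg (h \<cdot> k))"
    using fin assms by (intro sum_mono2) auto
  moreover have "deg (h \<cdot> i) > 0" "deg (h \<cdot> j) > 0"
    using assms deg_Comp_Sigma_pos by auto
  ultimately show False
    using \<open>i \<noteq> j\<close> by simp
qed

lemma monic_if_deg_one:
  assumes h: "h \<in> Arr D" and deg: "deg h = 1"
  shows "monic D h"
proof (rule monic_D_I[OF h])
  fix x y
  assume x: "x \<in> Arr D" "Cod C x = Dom C h" and y: "y \<in> Arr D" "Cod C y = Dom C h"
    and xy: "Dom C x = Dom C y" "h \<cdot> x = h \<cdot> y"
  let ?B = "Dom C h"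
  have B: "?B \<in> Obj D" "?B \<in> Obj C"
    using h by (auto simp: Arr_D_iff Dom_Obj)
  obtain p q where pb: "pullback C h h p q"
    using pullbacks h by blast
  then have pq: "p \<in> Arr C" "q \<in> Arr C" "Dom C p = Dom C q" "Cod C p = ?B" "Cod C q = ?B"
    by (auto simp: pullback_def)
  have deg_q: "deg q = 1"
    using deg_pullback[OF h h pb] deg by simp
  \<comment> \<open>\<open>d\<close> is the diagonal of the kernel pair.\<close>
  obtain d where d: "d \<in> Arr C" "Dom C d = ?B" "Cod C d = Dom C p"
    "p \<cdot> d = Ide C ?B" "q \<cdot> d = Ide C ?B"
    using pullback_lift[OF pb, of "Ide C ?B" "Ide C ?B"] B by (auto simp: Ide_Arr Dom_Ide Cod_Ide)
  obtain i s where i: "i \<in> \<Sigma> (Dom C q)" "i \<in> Arr C" "Dom C i \<in> Obj D" "Cod C i = Dom C q"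
    and s: "s \<in> Arr D" "Dom C s = ?B" "Cod C s = Dom C i" "i \<cdot> s = d"
    using Sigma_factor[of d "Dom C q"] d B pq by auto
  have sC: "s \<in> Arr C"
    using s by (simp add: Arr_D_iff)
  have pi: "p \<cdot> i \<in> Arr C" "Dom C (p \<cdot> i) = Dom C i" "Cod C (p \<cdot> i) = ?B"
    and qi: "q \<cdot> i \<in> Arr C" "Dom C (q \<cdot> i) = Dom C i" "Cod C (q \<cdot> i) = ?B"
    using pq i by (auto simp: Comp_Arr Dom_Comp Cod_Comp)
  have pis: "p \<cdot> i \<cdot> s = Ide C ?B" and qis: "q \<cdot> i \<cdot> s = Ide C ?B"
    using d(4,5) s(3) sC i pq unfolding s(4)[symmetric] by (auto simp: Comp_assoc)
  \<comment> \<open>Both sides are left inverses of the epic \<open>s\<close>. They are covers,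
    unlike possibly \<open>p\<close> and \<open>q\<close> themselves, so \<open>s\<close> can be
    cancelled inside \<open>D\<close>.\<close>
  have piqi: "p \<cdot> i = q \<cdot> i"
  proof (rule cover_cancel_right[OF s(1)])
    show "p \<cdot> i \<in> Arr D" "q \<cdot> i \<in> Arr D"
      unfolding Arr_D_iff using pi qi i(3) B by simp_all
  qed (use pi qi pis qis s(3) in simp_all)
  obtain u where u: "u \<in> Arr C" "Dom C u = Dom C x" "Cod C u = Dom C p" "p \<cdot> u = x" "q \<cdot> u = y"
    using pullback_lift[OF pb, of x y] x y xy by (auto simp: Arr_D_iff)
  obtain j t where j: "j \<in> \<Sigma> (Dom C q)"
    and t: "t \<in> Arr D" "Cod C t = Dom C j" "j \<cdot> t = u"
    using Sigma_factor[of u "Dom C q"] u(1-3) x(1) pq(3) unfolding Arr_D_iff by metis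
  have "j = i"
    using deg_one_Sigma_unique[OF pq(2) _ deg_q j i(1)] pq B by simp
  then have "x = p \<cdot> i \<cdot> t" "y = q \<cdot> i \<cdot> t"
    using u(4,5) t(1,2) i pq unfolding t(3)[symmetric] by (auto simp: Comp_assoc Arr_D_iff)
  then show "x = y"
    using piqi by simp
qed

lemma isomorphism_if_deg_one:
  assumes "h \<in> Arr D" "deg h = 1"
  obtains k where "k \<in> Arr D" "inverse_arrows C h k"
  using monic_iso[OF monic_if_deg_one] assms by blast

end

section \<open>The map \<open>\<Phi>\<close> for a fixed pullback with apex
  \<open>Dom C p\<close>\<close>

locale cover_pullback = cover_setting +
  fixes f g p q
  assumes f: "f \<in> Arr D" and g: "g \<in> Arr D" and pb: "pullback C f g p q"
begin

abbreviation \<Phi> where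
  "\<Phi> i \<equiv> p \<cdot> i \<cdot> inv_arrow C (q \<cdot> i)"

abbreviation Sigma1 where
  "Sigma1 \<equiv> {i \<in> \<Sigma> (Dom C p). deg (q \<cdot> i) = 1}"

lemma projections: "p \<in> Arr C" "q \<in> Arr C" "Dom C q = Dom C p" "Cod C p = Dom C f"
    "Cod C q = Dom C g" "f \<cdot> p = g \<cdot> q"
  and legs: "f \<in> Arr C" "g \<in> Arr C" "Dom C f \<in> Obj D" "Dom C g \<in> Obj D"
  using pb f g by (auto simp: pullback_def Arr_D_iff)

text \<open>The apex may lie outside \<open>D\<close>, so \<open>q\<close> need not be a cover;
  restricting along \<open>i\<close> moves the domain into \<open>D\<close>, and fullness makes
  \<open>q \<cdot> i\<close> a cover.\<close>

lemma Sigma_domain: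
  assumes "i \<in> \<Sigma> (Dom C p)"
  shows "i \<in> Arr C" "Dom C i \<in> Obj D" "Cod C i = Dom C p"
    and "q \<cdot> i \<in> Arr D" "Dom C (q \<cdot> i) = Dom C i" "Cod C (q \<cdot> i) = Dom C g"
  using Sigma_Arr[OF Dom_Obj assms] projections legs
  by (auto simp: Arr_D_iff Comp_Arr Dom_Comp Cod_Comp)

text \<open>Composing \<open>i\<close> with the inverse \<open>k\<close> of
  \<open>q \<cdot> i\<close> gives a section of \<open>q\<close> whose \<open>p\<close>-component is
  \<open>\<Phi> i\<close>. Later arguments use this section in place of
  \<open>inv_arrow\<close>.\<close>

lemma section_of_Sigma1:
  assumes "i \<in> Sigma1"
  obtains k where "inverse_arrows C (q \<cdot> i) k" "k \<in> Arr D" "Dom C k = Dom C g" "Cod C k = Dom C i"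
    "i \<cdot> k \<in> Arr C" "Dom C (i \<cdot> k) = Dom C g" "Cod C (i \<cdot> k) = Dom C p"
    "p \<cdot> (i \<cdot> k) = \<Phi> i" "q \<cdot> (i \<cdot> k) = Ide C (Dom C g)"
proof -
  note i = Sigma_domain[of i]
  obtain k where k: "k \<in> Arr D" "inverse_arrows C (q \<cdot> i) k"
    using isomorphism_if_deg_one[of "q \<cdot> i"] assms i by auto
  then have kC: "k \<in> Arr C" "Dom C k = Dom C g" "Cod C k = Dom C i"
    and qik: "q \<cdot> i \<cdot> k = Ide C (Dom C g)"
    using assms i by (auto simp: inverse_arrows_def)
  have "\<Phi> i = p \<cdot> i \<cdot> k"
    using inv_arrow_eq[OF category_axioms k(2)] by simp
  with that[OF k(2,1)] kC qik assms i projections show thesis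
    by (auto simp: Comp_assoc Comp_Arr Dom_Comp Cod_Comp)
qed

text \<open>The pullback square, composed with the section \<open>i \<cdot> k\<close> of
  \<open>q\<close>, reads \<open>f \<cdot> \<Phi> i = g\<close>.\<close>

lemma \<Phi>_Hom:
  assumes "i \<in> Sigma1"
  shows "\<Phi> i \<in> Hom C g f"
proof -
  obtain k where k: "i \<cdot> k \<in> Arr C" "Dom C (i \<cdot> k) = Dom C g" "Cod C (i \<cdot> k) = Dom C p"
    "p \<cdot> (i \<cdot> k) = \<Phi> i" "q \<cdot> (i \<cdot> k) = Ide C (Dom C g)"
    using section_of_Sigma1[OF assms] .
  have "f \<cdot> (p \<cdot> (i \<cdot> k)) = f \<cdot> p \<cdot> (i \<cdot> k)"
    using k(1-3) projections(1,4) legs by (simp add: Comp_assoc)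
  also have "\<dots> = g \<cdot> (q \<cdot> (i \<cdot> k))"
    unfolding projections(6) using k(1-3) projections legs by (simp add: Comp_assoc)
  finally have "f \<cdot> \<Phi> i = g"
    using k legs by (simp add: Comp_Ide_right)
  moreover have "\<Phi> i \<in> Arr C" "Dom C (\<Phi> i) = Dom C g" "Cod C (\<Phi> i) = Dom C f"
    unfolding k(4)[symmetric] using k(1-3) projections by (auto simp: Comp_Arr Dom_Comp Cod_Comp)
  ultimately show ?thesis
    by (simp add: Hom_def)
qed

text \<open>Sections of \<open>q\<close> share their \<open>q\<close>-component, so equal
  \<open>p\<close>-components make them equal; a single arrow then factors through both
  \<open>i\<close> and \<open>j\<close>.\<close>

lemma \<Phi>_inj: "inj_on \<Phi> Sigma1"
proof (rule inj_onI)
  fix i j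
  assume i: "i \<in> Sigma1" and j: "j \<in> Sigma1" and eq: "\<Phi> i = \<Phi> j"
  obtain k where k: "k \<in> Arr D" "Cod C k = Dom C i"
    and ik: "i \<cdot> k \<in> Arr C" "Dom C (i \<cdot> k) = Dom C g" "Cod C (i \<cdot> k) = Dom C p"
    "p \<cdot> (i \<cdot> k) = \<Phi> i" "q \<cdot> (i \<cdot> k) = Ide C (Dom C g)"
    using section_of_Sigma1[OF i] .
  obtain l where l: "l \<in> Arr D" "Cod C l = Dom C j"
    and jl: "j \<cdot> l \<in> Arr C" "Dom C (j \<cdot> l) = Dom C g" "Cod C (j \<cdot> l) = Dom C p"
    "p \<cdot> (j \<cdot> l) = \<Phi> j" "q \<cdot> (j \<cdot> l) = Ide C (Dom C g)"
    using section_of_Sigma1[OF j] .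
  have "i \<cdot> k = j \<cdot> l"
    by (rule pullback_jointly_monic[OF pb]) (use ik jl eq in auto)
  then show "i = j"
    using Sigma_unique[of i "Dom C p" j k l] i j k l projections by (simp add: Dom_Obj)
qed

text \<open>The pair of \<open>h\<close> and the identity lifts to a section \<open>u\<close> of
  \<open>q\<close>; the preimage of \<open>h\<close> is the element of \<open>\<Sigma>\<close>
  through which \<open>u\<close> factors.\<close>

lemma \<Phi>_surj:
  assumes "h \<in> Hom C g f"
  shows "h \<in> \<Phi> ` Sigma1"
proof -
  have h: "h \<in> Arr C" "Dom C h = Dom C g" "Cod C h = Dom C f" "g = f \<cdot> h"
    using assms unfolding Hom_def by blast+
  have I: "Ide C (Dom C g) \<in> Arr C" "Dom C (Ide C (Dom C g)) = Dom C g"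
    "Cod C (Ide C (Dom C g)) = Dom C g"
    using legs by (auto simp: Ide_Arr Dom_Ide Cod_Ide Dom_Obj)
  have "f \<cdot> h = g \<cdot> Ide C (Dom C g)"
    using h(4) Comp_Ide_right[OF legs(2)] by argo
  then obtain u where u: "u \<in> Arr C" "Dom C u = Dom C g" "Cod C u = Dom C p"
    "p \<cdot> u = h" "q \<cdot> u = Ide C (Dom C g)"
    using pullback_lift[OF pb h(1) I(1) _ h(3) I(3)] h(2) I(2) by metis
  obtain i s where i: "i \<in> \<Sigma> (Dom C p)"
    and s: "s \<in> Arr D" "Dom C s = Dom C g" "Cod C s = Dom C i" "i \<cdot> s = u"
    using Sigma_factor[of u "Dom C p"] u(1-3) legs(4) by metis
  note iC = Sigma_domain[OF i]
  have sC: "s \<in> Arr C"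
    using s by (simp add: Arr_D_iff)
  have qis: "q \<cdot> i \<cdot> s = Ide C (Dom C g)" and pis: "p \<cdot> i \<cdot> s = h"
    using u(4,5) s(3) sC iC(1,3) projections unfolding s(4)[symmetric] by (auto simp: Comp_assoc)
  \<comment> \<open>The composite of these two covers is an identity, of degree 1; a product of
    naturals equal to 1 has both factors 1.\<close>
  have "deg (q \<cdot> i) * deg s = 1"
    using deg_mult[of s "q \<cdot> i"] qis deg_Ide sC s(3) iC legs by (simp add: Arr_D_iff)
  then have "i \<in> Sigma1"
    using i by simp
  \<comment> \<open>The right inverse \<open>s\<close> of \<open>q \<cdot> i\<close> is two-sided,
    hence it is the inverse occurring in \<open>\<Phi> i\<close>.\<close>
  moreover have "inverse_arrows C (q \<cdot> i) s"
    using qis s(1-3) iC by (intro left_inverse_cover_inverse_arrows) auto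
  then have "\<Phi> i = h"
    using inv_arrow_eq[OF category_axioms] pis by simp
  ultimately show ?thesis
    by blast
qed

lemma \<Phi>_bij: "bij_betw \<Phi> Sigma1 (Hom C g f)"
  using \<Phi>_inj \<Phi>_Hom \<Phi>_surj unfolding bij_betw_def by blast

text \<open>(G4)(III) replaces \<open>deg f\<close> by \<open>deg q\<close>, to which (G4)(II)
  applies.\<close>

lemma finite_Sigma: "finite (\<Sigma> (Dom C p))"
  and deg_f_eq_sum: "deg f = (\<Sum>i\<in>\<Sigma> (Dom C p). deg (q \<cdot> i))"
proof -
  have "Cod C q \<in> Obj D"
    using projections legs by simp
  note sum = deg_sum[OF projections(2) this, unfolded projections(3)]
  show "finite (\<Sigma> (Dom C p))"
    using sum by blast
  have "deg f = deg q"
    using deg_pullback[OF f g pb] by blast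
  also have "\<dots> = (\<Sum>i\<in>\<Sigma> (Dom C p). deg (q \<cdot> i))"
    using sum by blast
  finally show "deg f = (\<Sum>i\<in>\<Sigma> (Dom C p). deg (q \<cdot> i))" .
qed

text \<open>As \<open>card\<close> is 0 on infinite sets, finiteness is what gives the bound on
  \<open>card\<close> its content.\<close>

lemma finite_Hom: "finite (Hom C g f)"
  using bij_betw_finite[OF \<Phi>_bij] finite_Sigma by simp

text \<open>Through \<open>\<Phi>\<close>, the left side counts the terms equal to 1 in the sum that
  computes \<open>deg f\<close>.\<close>

lemma card_Hom_le: "card (Hom C g f) \<le> deg f"
  and card_Hom_eq_iff: "card (Hom C g f) = deg f \<longleftrightarrow> (\<forall>i\<in>\<Sigma> (Dom C p). deg (q \<cdot> i) = 1)"
proof -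
  have pos: "deg (q \<cdot> i) > 0" if "i \<in> \<Sigma> (Dom C p)" for i
    using deg_Comp_Sigma_pos[of q i] that projections legs by simp
  have card: "card (Hom C g f) = card Sigma1"
    using bij_betw_same_card[OF \<Phi>_bij] by simp
  show "card (Hom C g f) \<le> deg f"
    unfolding card deg_f_eq_sum using finite_Sigma pos by (rule card_eq_one_terms_le_sum)
  show "card (Hom C g f) = deg f \<longleftrightarrow> (\<forall>i\<in>\<Sigma> (Dom C p). deg (q \<cdot> i) = 1)"
    unfolding card deg_f_eq_sum using finite_Sigma pos by (rule card_eq_one_terms_le_sum)
qed

end

theorem theorem3p10:
  fixes C D :: "('o, 'a) cat"
    and \<Sigma> :: "'o \<Rightarrow> 'a set"
    and deg :: "'a \<Rightarrow> nat"
    and f g p q :: 'a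
    and U :: 'o
  assumes "cover_setting C D \<Sigma> deg"
    and "f \<in> Arr D" and "g \<in> Arr D" and "Cod C f = Cod C g"
    and "pullback C f g p q" and "Dom C p = U"
  shows "(\<forall>i\<in>\<Sigma> U. deg (q \<cdot>\<^bsub>C\<^esub> i) = 1 \<longrightarrow> q \<cdot>\<^bsub>C\<^esub> i \<in> Arr D \<and> isomorphism C (q \<cdot>\<^bsub>C\<^esub> i)) \<and>
    bij_betw (\<lambda>i. p \<cdot>\<^bsub>C\<^esub> i \<cdot>\<^bsub>C\<^esub> inv_arrow C (q \<cdot>\<^bsub>C\<^esub> i))
      {i \<in> \<Sigma> U. deg (q \<cdot>\<^bsub>C\<^esub> i) = 1} (Hom C g f) \<and>
    finite (Hom C g f) \<and>
    card (Hom C g f) \<le> deg f \<and>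
    (card (Hom C g f) = deg f \<longleftrightarrow> (\<forall>i\<in>\<Sigma> U. deg (q \<cdot>\<^bsub>C\<^esub> i) = 1))"
proof -
  interpret cover_pullback C D \<Sigma> deg f g p q
    using assms by (simp add: cover_pullback_def cover_pullback_axioms_def)
  have "q \<cdot>\<^bsub>C\<^esub> i \<in> Arr D \<and> isomorphism C (q \<cdot>\<^bsub>C\<^esub> i)" if "i \<in> \<Sigma> U" "deg (q \<cdot>\<^bsub>C\<^esub> i) = 1" for i
    using that isomorphism_if_deg_one[of "q \<cdot>\<^bsub>C\<^esub> i"] Sigma_domain(4)[of i] assms(6)
    unfolding isomorphism_def by metis
  with \<Phi>_bij finite_Hom card_Hom_le card_Hom_eq_iff show ?thesis
    unfolding assms(6) by blast
qed

end
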